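(* For any integer $n>1$, the multiplicity of $n$ as a Laplacian eigenvalue of the power graph $\mathcal{G}(\mathbb{Z}_n)$ is $\phi(n)+1$ if and only if $n=4$ or $n$ is not a prime power.
   Context: $\mathbb{Z}_n$ is the additive cyclic group of order $n$; $\phi$ is Euler's phi function. The power graph $\mathcal{G}(G)$ of a group $G$ has vertex set $G$, distinct $u,v$ adjacent iff one is a positive power of the other. Laplacian eigenvalues are the eigenvalues of $L(\Gamma)=D(\Gamma)-A(\Gamma)$ (degree matrix minus adjacency matrix). A prime power means $p^\alpha$ with $p$ prime and $\alpha\in\mathbb{N}$. *)

theory Defs
  imports
    "HOL-Number_Theory.Totient"
    "HOL-Number_Theory.Prime_Powers"
    "HOL-Algebra.Elementary_Groups"
    "Graph_Theory.Pair_Digraph"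
    "Jordan_Normal_Form.Char_Poly"
begin

text \<open>
  An undirected graph is represented, as usual in \<open>Graph_Theory\<close>, by a digraph with a symmetric
  arc relation. Exponents in the power graph are positive, following the definition
  ``one is a positive power of the other''.
\<close>

definition power_graph :: "('a, 'b) monoid_scheme \<Rightarrow> 'a pair_pre_digraph" where
  "power_graph G =
     \<lparr> pverts = carrier G,
       parcs = {(u, v). u \<in> carrier G \<and> v \<in> carrier G \<and> u \<noteq> v \<and>
                  ((\<exists>k::nat. k > 0 \<and> v = u [^]\<^bsub>G\<^esub> k) \<or> (\<exists>k::nat. k > 0 \<and> u = v [^]\<^bsub>G\<^esub> k))} \<rparr>"

lemma pair_graph_power_graph:
  assumes "finite (carrier G)"
  shows "pair_graph (power_graph G)"
proof -
  have sub: "parcs (power_graph G) \<subseteq> carrier G \<times> carrier G"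
    by (auto simp: power_graph_def)
  show ?thesis
    by unfold_locales
       (use assms finite_subset[OF sub] in
         \<open>auto simp: power_graph_def symmetric_def intro!: symI\<close>)
qed

text \<open>
  Matrices are indexed by \<open>0..<n\<close>, so the rows and columns of a graph matrix are labelled by an
  enumeration of the vertices, here the increasing one. Another enumeration conjugates the matrix
  by a permutation and leaves the characteristic polynomial unchanged.

  In a symmetric digraph \<^const>\<open>out_degree\<close> is the degree of the undirected graph.
\<close>

abbreviation vertex_list :: "'a::linorder pair_pre_digraph \<Rightarrow> 'a list" where
  "vertex_list \<Gamma> \<equiv> sorted_list_of_set (pverts \<Gamma>)"

definition degree_matrix :: "'a::linorder pair_pre_digraph \<Rightarrow> real mat" where
  "degree_matrix \<Gamma> = (let vs = vertex_list \<Gamma> in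
     Matrix.mat (length vs) (length vs)
       (\<lambda>(i, j). if i = j then real (out_degree (with_proj \<Gamma>) (vs ! i)) else 0))"

definition adjacency_matrix :: "'a::linorder pair_pre_digraph \<Rightarrow> real mat" where
  "adjacency_matrix \<Gamma> = (let vs = vertex_list \<Gamma> in
     Matrix.mat (length vs) (length vs)
       (\<lambda>(i, j). if (vs ! i, vs ! j) \<in> parcs \<Gamma> then 1 else 0))"

definition laplacian_matrix :: "'a::linorder pair_pre_digraph \<Rightarrow> real mat" where
  "laplacian_matrix \<Gamma> = degree_matrix \<Gamma> - adjacency_matrix \<Gamma>"

text \<open>
  The algebraic multiplicity, which is \<open>0\<close> if \<open>x\<close> is not an eigenvalue. The Laplacian matrix is
  real symmetric, so it coincides with the geometric one.
\<close>

definition laplacian_multiplicity :: "'a::linorder pair_pre_digraph \<Rightarrow> real \<Rightarrow> nat" where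
  "laplacian_multiplicity \<Gamma> x = Polynomial.order x (char_poly (laplacian_matrix \<Gamma>))"

end

theory Submission
  imports Defs
begin

text \<open>
  Call a vertex dominating if it is adjacent to all others. If the non-dominating vertices of a
  graph on \<open>n\<close> vertices exist and are connected in the complement, then the multiplicity of \<open>n\<close> as a
  Laplacian eigenvalue is the number of dominating vertices; for a complete graph it is \<open>n - 1\<close>. In
  the power graph of \<open>\<int>\<^sub>n\<close> two elements are adjacent iff their gcds with \<open>n\<close> are comparable under
  divisibility. So \<open>0\<close> and the \<open>\<phi>(n)\<close> generators are always dominating, and the graph is complete if
  \<open>n\<close> is a prime power; then \<open>n - 1 = \<phi>(n) + 1\<close> only for \<open>n = 4\<close>. Otherwise the prime powers exactly
  dividing \<open>n\<close> are pairwise incomparable, and every divisor of \<open>n\<close> other than \<open>1\<close> and \<open>n\<close> is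
  incomparable with one of them, which makes the complement connected on the remaining vertices.
\<close>

section \<open>Simultaneous row operations\<close>

text \<open>Each row of \<open>S\<close> is added by one \<open>addrow\<close>, which preserves the
  determinant; as \<open>r\<close> is not in \<open>S\<close>, the added rows themselves never
  change.\<close>

lemma det_add_rows_to_row:
  fixes f :: "nat \<Rightarrow> nat \<Rightarrow> 'a::comm_ring_1"
  assumes "finite S" "S \<subseteq> {..<n}" "r < n" "r \<notin> S"
  shows "det (mat n n (\<lambda>(i, j). if i = r then f r j + (\<Sum>k\<in>S. f k j) else f i j)) =
         det (mat n n (\<lambda>(i, j). f i j))"
  using assms
proof (induction S rule: finite_induct)
  case empty
  have "mat n n (\<lambda>(i, j). if i = r then f r j + (\<Sum>k\<in>{}. f k j) else f i j) = mat n n (\<lambda>(i, j). f i j)"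
    by (rule eq_matI) auto
  then show ?case by simp
next
  case (insert x S)
  let ?A = "mat n n (\<lambda>(i, j). if i = r then f r j + (\<Sum>k\<in>S. f k j) else f i j)"
  have "mat n n (\<lambda>(i, j). if i = r then f r j + (\<Sum>k\<in>insert x S. f k j) else f i j) = addrow 1 r x ?A"
    using insert by (intro eq_matI) (auto simp: algebra_simps)
  moreover have "det (addrow 1 r x ?A) = det ?A"
    using insert by (intro det_addrow[where n = n]) auto
  ultimately show ?case
    using insert by simp
qed

lemma det_add_row_to_rows:
  fixes f :: "nat \<Rightarrow> nat \<Rightarrow> 'a::comm_ring_1"
  assumes "finite S" "S \<subseteq> {..<n}" "r < n" "r \<notin> S"
  shows "det (mat n n (\<lambda>(i, j). if i \<in> S then f i j + c * f r j else f i j)) =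
         det (mat n n (\<lambda>(i, j). f i j))"
  using assms
proof (induction S rule: finite_induct)
  case empty
  then show ?case by simp
next
  case (insert x S)
  let ?A = "mat n n (\<lambda>(i, j). if i \<in> S then f i j + c * f r j else f i j)"
  have "mat n n (\<lambda>(i, j). if i \<in> insert x S then f i j + c * f r j else f i j) = addrow c x r ?A"
    using insert by (intro eq_matI) (auto simp: algebra_simps)
  moreover have "det (addrow c x r ?A) = det ?A"
    using insert by (intro det_addrow[where n = n]) auto
  ultimately show ?case
    using insert by simp
qed

lemma det_mult_rows:
  fixes f :: "nat \<Rightarrow> nat \<Rightarrow> 'a::comm_ring_1"
  assumes "finite S" "S \<subseteq> {..<n}"
  shows "det (mat n n (\<lambda>(i, j). if i \<in> S then c * f i j else f i j)) =
         c ^ card S * det (mat n n (\<lambda>(i, j). f i j))"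
  using assms
proof (induction S rule: finite_induct)
  case empty
  then show ?case by simp
next
  case (insert x S)
  let ?A = "mat n n (\<lambda>(i, j). if i \<in> S then c * f i j else f i j)"
  have "mat n n (\<lambda>(i, j). if i \<in> insert x S then c * f i j else f i j) = multrow x c ?A"
    using insert by (intro eq_matI) auto
  moreover have "det (multrow x c ?A) = c * det ?A"
    using insert by (intro det_multrow[where n = n]) auto
  ultimately show ?case
    using insert by (simp add: mult.assoc)
qed

section \<open>The eigenvalue \<open>n\<close> of the Laplacian of a graph on \<open>n\<close> vertices\<close>

text \<open>Vertices are the numbers below \<open>n\<close>, so they double as matrix indices;
  \<open>E\<close> is not confined to them, hence the bounds in the definitions.\<close>

locale nat_graph =
  fixes n :: nat and E :: "nat \<Rightarrow> nat \<Rightarrow> bool"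
  assumes sym: "E i j \<Longrightarrow> E j i" and irrefl: "\<not> E i i"
begin

definition degree :: "nat \<Rightarrow> nat" where
  "degree i = card {j. j < n \<and> E i j}"

definition laplacian :: "real mat" where
  "laplacian = mat n n (\<lambda>(i, j). if i = j then real (degree i) else if E i j then - 1 else 0)"

definition dominating :: "nat \<Rightarrow> bool" where
  "dominating i \<longleftrightarrow> (\<forall>j<n. j \<noteq> i \<longrightarrow> E i j)"

definition coedge :: "nat \<Rightarrow> nat \<Rightarrow> bool" where
  "coedge i j \<longleftrightarrow> i < n \<and> j < n \<and> i \<noteq> j \<and> \<not> E i j"

lemma E_commute: "E i j \<longleftrightarrow> E j i"
  using sym[of i j] sym[of j i] by blast

lemma coedge_sym: "coedge i j \<Longrightarrow> coedge j i"
  using sym by (auto simp: coedge_def)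

lemma degree_dominating:
  assumes "i < n" "dominating i"
  shows "degree i = n - 1"
proof -
  have "{j. j < n \<and> E i j} = {..<n} - {i}"
    using assms irrefl by (auto simp: dominating_def)
  then show ?thesis using assms by (simp add: degree_def)
qed

lemma card_coedge:
  assumes "i < n"
  shows "real (card {j. coedge i j}) = real n - 1 - real (degree i)"
proof -
  have "{..<n} = insert i ({j. coedge i j} \<union> {j. j < n \<and> E i j})"
    using assms by (auto simp: coedge_def)
  moreover have fin: "finite {j. coedge i j}"
    by (rule finite_subset[of _ "{..<n}"]) (auto simp: coedge_def)
  moreover have "card ({j. coedge i j} \<union> {j. j < n \<and> E i j}) = card {j. coedge i j} + degree i"
    unfolding degree_def using fin by (intro card_Un_disjoint) (auto simp: coedge_def)
  moreover have "i \<notin> {j. coedge i j} \<union> {j. j < n \<and> E i j}"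
    using irrefl by (simp add: coedge_def)
  ultimately have "n = Suc (card {j. coedge i j} + degree i)"
    using card_insert_disjoint[of "{j. coedge i j} \<union> {j. j < n \<and> E i j}" i] card_lessThan[of n]
    by simp
  then show ?thesis by linarith
qed

text \<open>Summing \<open>v i - v r\<close> times the \<open>i\<close>-th equation gives half the Dirichlet energy of \<open>v\<close>.
  The shift by \<open>v r\<close> makes the equation at \<open>r\<close> dispensable.\<close>
lemma constant_of_harmonic:
  fixes v :: "nat \<Rightarrow> real"
  assumes harmonic: "\<And>i. i < n \<Longrightarrow> i \<noteq> r \<Longrightarrow> (\<Sum>j | coedge i j. v i - v j) = 0"
    and "coedge i j"
  shows "v i = v j"
proof -
  define w where "w i j = (if coedge i j then 1 else 0 :: real)" for i j
  have w_sym: "w i j = w j i" for i j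
    using coedge_sym by (auto simp: w_def)
  have row: "(\<Sum>j<n. w i j * (v i - v j)) = (\<Sum>j | coedge i j. v i - v j)" for i
    by (rule sum.mono_neutral_cong_right) (auto simp: w_def coedge_def)
  let ?T = "\<Sum>i<n. \<Sum>j<n. w i j * (v i - v r) * (v i - v j)"
  have "(\<Sum>j<n. w i j * (v i - v r) * (v i - v j)) = 0" if "i < n" for i
  proof -
    have "(\<Sum>j<n. w i j * (v i - v r) * (v i - v j)) = (v i - v r) * (\<Sum>j<n. w i j * (v i - v j))"
      by (simp add: sum_distrib_left algebra_simps)
    then show ?thesis using harmonic[OF that] by (cases "i = r") (auto simp: row)
  qed
  then have T0: "?T = 0" by simp
  \<comment> \<open>Swapping the indices gives \<open>?T\<close> again; in the total of both forms
    the factors combine to the square of \<open>v i - v j\<close>.\<close>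
  have T': "?T = (\<Sum>i<n. \<Sum>j<n. w i j * (v j - v r) * (v j - v i))"
    by (subst sum.swap) (simp add: w_sym)
  have "(\<Sum>i<n. \<Sum>j<n. w i j * (v i - v j)\<^sup>2) =
      ?T + (\<Sum>i<n. \<Sum>j<n. w i j * (v j - v r) * (v j - v i))"
    unfolding sum.distrib[symmetric]
    by (intro sum.cong refl) (simp add: algebra_simps power2_eq_square)
  then have "(\<Sum>i<n. \<Sum>j<n. w i j * (v i - v j)\<^sup>2) = 0"
    using T0 T' by simp
  then have "\<forall>i<n. \<forall>j<n. w i j * (v i - v j)\<^sup>2 = 0"
    by (simp add: sum_nonneg_eq_0_iff sum_nonneg w_def)
  moreover have "i < n" "j < n" using assms(2) by (auto simp: coedge_def)
  ultimately have "w i j * (v i - v j)\<^sup>2 = 0" by blast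
  then show ?thesis using assms(2) by (simp add: w_def)
qed

text \<open>What remains of \<open>t I - L\<close> after the row operations below: \<open>t\<close>
  has been taken out of row \<open>r\<close>, and \<open>t - n\<close> out of every other dominating
  row.\<close>

definition reduced :: "nat \<Rightarrow> real \<Rightarrow> real mat" where
  "reduced r t = mat n n (\<lambda>(i, j). if i = r then 1
     else if dominating i then (if i = j then 1 else 0)
     else if i = j then t - 1 - degree i else if E i j then 0 else - 1)"

text \<open>A kernel vector vanishes at dominating vertices other than \<open>r\<close> and is
  harmonic for the complement away from \<open>r\<close>, hence constant on what is reachable from
  \<open>r\<close>. The all-ones row \<open>r\<close> makes its entries sum to zero, so the constant
  is zero too.\<close>

lemma det_reduced_nonzero:
  assumes "r < n" and conn: "\<And>i. i < n \<Longrightarrow> dominating i \<or> coedge\<^sup>*\<^sup>* r i"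
  shows "det (reduced r (real n)) \<noteq> 0"
proof
  assume det0: "det (reduced r (real n)) = 0"
  have carr: "reduced r (real n) \<in> carrier_mat n n" by (simp add: reduced_def)
  obtain u where u: "u \<in> carrier_vec n" "u \<noteq> 0\<^sub>v n" "reduced r (real n) *\<^sub>v u = 0\<^sub>v n"
    using det_0_iff_vec_prod_zero_field[OF carr] det0 by auto
  define v where "v i = u $ i" for i
  have row: "(\<Sum>j<n. reduced r (real n) $$ (i, j) * v j) = 0" if "i < n" for i
  proof -
    have "(reduced r (real n) *\<^sub>v u) $ i = (\<Sum>j<n. reduced r (real n) $$ (i, j) * v j)"
      using that carr u(1) by (auto simp: scalar_prod_def v_def lessThan_atLeast0 intro!: sum.cong)
    then show ?thesis using u(3) that by simp
  qed
  have sum0: "(\<Sum>j<n. v j) = 0"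
    using row[OF \<open>r < n\<close>] \<open>r < n\<close> by (simp add: reduced_def)
  have dom0: "v i = 0" if "i < n" "i \<noteq> r" "dominating i" for i
  proof -
    have "(\<Sum>j<n. reduced r (real n) $$ (i, j) * v j) = (\<Sum>j<n. if j = i then v j else 0)"
      using that by (intro sum.cong) (auto simp: reduced_def)
    then show ?thesis using row[OF that(1)] that by simp
  qed
  have harmonic: "(\<Sum>j | coedge i j. v i - v j) = 0" if "i < n" "i \<noteq> r" for i
  proof (cases "dominating i")
    case True
    then have "{j. coedge i j} = {}" by (auto simp: dominating_def coedge_def)
    then show ?thesis by simp
  next
    case False
    \<comment> \<open>At \<open>t = n\<close> the diagonal entry is the degree of \<open>i\<close>
      in the complement, so this is a row of the Laplacian of the complement.\<close>
    have "(\<Sum>j<n. reduced r (real n) $$ (i, j) * v j) =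
        (\<Sum>j<n. (if j = i then (real n - 1 - degree i) * v j else 0) - (if coedge i j then v j else 0))"
      using that False irrefl by (intro sum.cong) (auto simp: reduced_def coedge_def)
    also have "\<dots> = real (card {j. coedge i j}) * v i - (\<Sum>j<n. if coedge i j then v j else 0)"
      using that by (simp add: sum_subtractf card_coedge)
    also have "(\<Sum>j<n. if coedge i j then v j else 0) = (\<Sum>j | coedge i j. v j)"
      by (rule sum.mono_neutral_cong_right) (auto simp: coedge_def)
    finally show ?thesis using row[OF that(1)] by (simp add: sum_subtractf)
  qed
  define c where "c = v r"
  have reach: "v i = c" if "coedge\<^sup>*\<^sup>* r i" for i
    using that
  proof (induction rule: rtranclp_induct)
    case (step y z)
    then show ?case using constant_of_harmonic[OF harmonic step(2)] by simp
  qed (simp add: c_def)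
  \<comment> \<open>The vertex \<open>r\<close> keeps the value \<open>c\<close> even if it is
    dominating, as in a complete graph.\<close>
  have val: "v i = (if dominating i \<and> i \<noteq> r then 0 else c)" if "i < n" for i
    using conn[OF that] reach[of i] dom0[OF that] by (cases "i = r") (auto simp flip: c_def)
  have "(\<Sum>j<n. v j) = (\<Sum>j | j < n \<and> \<not> (dominating j \<and> j \<noteq> r). c)"
    by (rule sum.mono_neutral_cong_right) (auto simp: val)
  then have "real (card {j. j < n \<and> \<not> (dominating j \<and> j \<noteq> r)}) * c = 0"
    using sum0 by simp
  moreover have "card {j. j < n \<and> \<not> (dominating j \<and> j \<noteq> r)} \<noteq> 0"
    using \<open>r < n\<close> by (subst card_0_eq) auto
  ultimately have "c = 0" by (metis mult_eq_0_iff of_nat_eq_0_iff)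
  then have "u = 0\<^sub>v n"
    using u(1) val by (intro eq_vecI) (auto simp: v_def split: if_splits)
  with u(2) show False by simp
qed

text \<open>The columns of the Laplacian sum to zero, so only the \<open>t\<close> on the diagonal
  survives.\<close>

lemma column_sum:
  assumes "j < n"
  shows "(\<Sum>i<n. char_poly_matrix laplacian $$ (i, j)) = [:0, 1:]"
proof -
  have "(\<Sum>i<n. char_poly_matrix laplacian $$ (i, j)) =
      (\<Sum>i<n. (if i = j then [:- real (degree j), 1:] else 0) + (if E j i then 1 else 0))"
    using assms
    by (intro sum.cong) (auto simp: irrefl E_commute char_poly_matrix_def laplacian_def one_pCons)
  also have "\<dots> = [:- real (degree j), 1:] + (\<Sum>i | i < n \<and> E j i. 1)"
    using assms by (simp add: sum.distrib sum.If_cases Int_def)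
  also have "(\<Sum>i | i < n \<and> E j i. 1) = [:real (degree j):]"
    by (simp add: degree_def of_nat_poly)
  finally show ?thesis by simp
qed

text \<open>Adding all rows of \<open>t I - L\<close> to row \<open>r\<close> turns that row into \<open>(t, \<dots>, t)\<close>. Subtracting
  \<open>(1, \<dots>, 1)\<close> from the other rows turns every dominating row into \<open>t - n\<close> times a unit vector.\<close>
lemma char_poly_laplacian:
  assumes "r < n"
  defines "S \<equiv> {i. i < n \<and> i \<noteq> r \<and> dominating i}"
  obtains q where "char_poly laplacian = [:0, 1:] * ([:- real n, 1:] ^ card S * q)"
    and "\<And>t. poly q t = det (reduced r t)"
proof -
  \<comment> \<open>Entries at successive stages: \<open>Q\<close> for \<open>t I - L\<close>,
    \<open>Q1\<close> once \<open>t\<close> is taken out of the summed row \<open>r\<close>,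
    \<open>Q2\<close> once \<open>t - n\<close> is taken out of the rows in
    \<open>S\<close>.\<close>
  define Q where "Q i j = char_poly_matrix laplacian $$ (i, j)" for i j
  define Q1 where "Q1 i j = (if i = r then 1 else Q i j)" for i j
  define Q2 where "Q2 i j = (if i \<in> S then if i = j then 1 else 0
    else if i = r then 1 else Q i j - 1)" for i j
  have Q: "Q i j = (if i = j then [:- real (degree i), 1:] else if E i j then 1 else 0)"
    if "i < n" "j < n" for i j
    using that by (auto simp: Q_def char_poly_matrix_def laplacian_def one_pCons)
  have carr: "char_poly_matrix laplacian \<in> carrier_mat n n"
    by (simp add: laplacian_def)
  have col: "Q r j + (\<Sum>k\<in>{..<n} - {r}. Q k j) = [:0, 1:]" if "j < n" for j
    using column_sum[OF that] sum.remove[of "{..<n}" r "\<lambda>k. Q k j"] \<open>r < n\<close>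
    by (simp add: Q_def)
  have "char_poly laplacian = det (mat n n (\<lambda>(i, j). Q i j))"
    unfolding char_poly_def using carr by (intro arg_cong[of _ _ det] eq_matI) (auto simp: Q_def)
  also have "\<dots> = det (mat n n (\<lambda>(i, j). if i = r then Q r j + (\<Sum>k\<in>{..<n} - {r}. Q k j) else Q i j))"
    using assms by (intro det_add_rows_to_row[symmetric]) auto
  also have "mat n n (\<lambda>(i, j). if i = r then Q r j + (\<Sum>k\<in>{..<n} - {r}. Q k j) else Q i j) =
      mat n n (\<lambda>(i, j). if i \<in> {r} then [:0, 1:] * Q1 i j else Q1 i j)"
    by (intro eq_matI) (auto simp: Q1_def col)
  also have "det \<dots> = [:0, 1:] * det (mat n n (\<lambda>(i, j). Q1 i j))"
    using assms by (subst det_mult_rows) auto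
  also have "det (mat n n (\<lambda>(i, j). Q1 i j)) =
      det (mat n n (\<lambda>(i, j). if i \<in> {..<n} - {r} then Q1 i j + - 1 * Q1 r j else Q1 i j))"
    using assms by (intro det_add_row_to_rows[symmetric]) auto
  \<comment> \<open>A dominating row has \<open>t - (n - 1)\<close> on the diagonal and 1 elsewhere;
    subtracting the ones leaves \<open>t - n\<close> and 0.\<close>
  also have "mat n n (\<lambda>(i, j). if i \<in> {..<n} - {r} then Q1 i j + - 1 * Q1 r j else Q1 i j) =
      mat n n (\<lambda>(i, j). if i \<in> S then [:- real n, 1:] * Q2 i j else Q2 i j)"
    using assms degree_dominating
    by (intro eq_matI)
      (auto simp: Q1_def Q2_def Q one_pCons of_nat_diff dominating_def)
  also have "det \<dots> = [:- real n, 1:] ^ card S * det (mat n n (\<lambda>(i, j). Q2 i j))"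
    by (intro det_mult_rows) (auto simp: S_def)
  finally have "char_poly laplacian =
    [:0, 1:] * ([:- real n, 1:] ^ card S * det (mat n n (\<lambda>(i, j). Q2 i j)))" .
  moreover have "poly (det (mat n n (\<lambda>(i, j). Q2 i j))) t = det (reduced r t)" for t
  proof -
    \<comment> \<open>Evaluation at \<open>t\<close> is a ring homomorphism, so it commutes with
      \<open>det\<close>.\<close>
    have eval_at: "comm_ring_hom (\<lambda>p. poly p t)"
      by unfold_locales auto
    show ?thesis
      unfolding comm_ring_hom.hom_det[OF eval_at, symmetric] using assms
      by (intro arg_cong[of _ _ det] eq_matI) (auto simp: reduced_def Q2_def Q one_pCons)
  qed
  ultimately show thesis using that by blast
qed

text \<open>At \<open>n\<close> neither \<open>[:0, 1:]\<close> nor the cofactor \<open>q\<close>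
  vanishes. Leaving out \<open>r\<close> loses nothing if \<open>r\<close> is not dominating, and
  accounts for the value \<open>n - 1\<close> in a complete graph.\<close>

lemma order_char_poly_laplacian:
  assumes "r < n" and "\<And>i. i < n \<Longrightarrow> dominating i \<or> coedge\<^sup>*\<^sup>* r i"
  shows "Polynomial.order (real n) (char_poly laplacian) =
    card {i. i < n \<and> i \<noteq> r \<and> dominating i}"
proof -
  obtain q where q: "char_poly laplacian =
      [:0, 1:] * ([:- real n, 1:] ^ card {i. i < n \<and> i \<noteq> r \<and> dominating i} * q)"
    and "\<And>t. poly q t = det (reduced r t)"
    using char_poly_laplacian[OF assms(1)] by blast
  then have "poly q (real n) \<noteq> 0"
    using det_reduced_nonzero[OF assms] by simp
  then have "Polynomial.order (real n) q = 0" "q \<noteq> 0"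
    by (auto simp: order_0I)
  moreover have "Polynomial.order (real n) [:0, 1:] = 0"
    using assms(1) by (intro order_0I) simp
  ultimately show ?thesis
    unfolding q by (subst order_mult order_mult order_power_n_n; simp)+
qed

end

section \<open>The power graph of \<open>\<int>\<^sub>n\<close>\<close>

text \<open>Powers in the additive group are multiples, so this is the solvability criterion for a
  linear congruence modulo \<open>n\<close>.\<close>

lemma multiple_mod_iff_gcd_dvd:
  fixes u v n :: nat
  assumes "v < n"
  shows "(\<exists>k>0. int v = int k * int u mod int n) \<longleftrightarrow> gcd u n dvd v"
proof
  assume "\<exists>k>0. int v = int k * int u mod int n"
  then obtain k where "v = k * u mod n"
    by (metis of_nat_eq_iff of_nat_mod of_nat_mult)
  then show "gcd u n dvd v"
    by (simp add: dvd_mod)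
next
  assume "gcd u n dvd v"
  then obtain x where "[u * x = v] (mod n)"
    using cong_solve_dvd_nat by metis
  \<comment> \<open>Adding \<open>n\<close> makes the exponent positive even if
    \<open>x = 0\<close>.\<close>
  then have "(x + n) * u mod n = v"
    using assms by (simp add: cong_def algebra_simps)
  then have "int v = int (x + n) * int u mod int n"
    by (metis of_nat_mod of_nat_mult)
  moreover have "x + n > 0" using assms by simp
  ultimately show "\<exists>k>0. int v = int k * int u mod int n" by blast
qed

text \<open>Since \<open>gcd i n\<close> divides \<open>n\<close>, it divides \<open>j\<close> iff
  it divides \<open>gcd j n\<close>; so the two gcds are compared under divisibility.\<close>

definition gcd_comparable :: "nat \<Rightarrow> nat \<Rightarrow> nat \<Rightarrow> bool" where
  "gcd_comparable n i j \<longleftrightarrow> i \<noteq> j \<and> (gcd i n dvd j \<or> gcd j n dvd i)"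

interpretation zn: nat_graph n "gcd_comparable n" for n
  by unfold_locales (auto simp: gcd_comparable_def)

lemma power_graph_integer_mod_group_arc:
  assumes "i < n" "j < n"
  shows "(int i, int j) \<in> parcs (power_graph (integer_mod_group n)) \<longleftrightarrow> gcd_comparable n i j"
  using assms multiple_mod_iff_gcd_dvd[of j n i] multiple_mod_iff_gcd_dvd[of i n j]
  by (auto simp: power_graph_def carrier_integer_mod_group gcd_comparable_def)

lemma vertex_list_integer_mod_group:
  assumes "n > 0"
  shows "vertex_list (power_graph (integer_mod_group n)) = map int [0..<n]"
proof -
  have "pverts (power_graph (integer_mod_group n)) = set (map int [0..<n])"
    using assms image_int_atLeastLessThan[of 0 n]
    by (simp add: power_graph_def carrier_integer_mod_group)
  moreover have "sorted (map int [0..<n])" "distinct (map int [0..<n])"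
    by (simp_all add: sorted_map distinct_map)
  ultimately show ?thesis
    by (metis sorted_list_of_set.idem_if_sorted_distinct)
qed

lemma out_degree_power_graph_integer_mod_group:
  assumes "i < n"
  shows "out_degree (with_proj (power_graph (integer_mod_group n))) (int i) = zn.degree n i"
proof -
  let ?\<Gamma> = "power_graph (integer_mod_group n)"
  have "out_arcs (with_proj ?\<Gamma>) (int i) = (\<lambda>j. (int i, int j)) ` {j. j < n \<and> gcd_comparable n i j}"
  proof -
    have "\<exists>j<n. y = int j" if "(x, y) \<in> parcs ?\<Gamma>" for x y
    proof -
      have "0 \<le> y" "y < int n"
        using that assms by (auto simp: power_graph_def carrier_integer_mod_group)
      then show ?thesis by (intro exI[of _ "nat y"]) auto
    qed
    then show ?thesis
      using assms power_graph_integer_mod_group_arc by (fastforce simp: out_arcs_def)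
  qed
  then show ?thesis
    by (simp add: out_degree_def zn.degree_def card_image inj_on_def)
qed

lemma laplacian_matrix_integer_mod_group:
  assumes "n > 0"
  shows "laplacian_matrix (power_graph (integer_mod_group n)) = zn.laplacian n"
  using assms
  by (intro eq_matI)
    (auto simp: laplacian_matrix_def degree_matrix_def adjacency_matrix_def Let_def zn.laplacian_def
      vertex_list_integer_mod_group out_degree_power_graph_integer_mod_group
      power_graph_integer_mod_group_arc zn.irrefl)

section \<open>Dominating vertices of the power graph\<close>

lemma card_zero_or_coprime:
  assumes "n > 1"
  shows "card {i. i < n \<and> (i = 0 \<or> coprime i n)} = totient n + 1"
proof -
  \<comment> \<open>As \<open>n > 1\<close>, \<open>n\<close> is not among its totatives, so these
    are the residues coprime to \<open>n\<close>; 0 is a further element.\<close>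
  have "{i. i < n \<and> (i = 0 \<or> coprime i n)} = insert 0 (totatives n)"
    using assms by (auto simp: totatives_def intro: nat_neq_iff le_neq_implies_less)
  then show ?thesis by (simp add: totient_def)
qed

lemma dominating_if_zero_or_coprime: "i = 0 \<or> coprime i n \<Longrightarrow> zn.dominating n i"
  by (auto simp: zn.dominating_def gcd_comparable_def)

text \<open>The divisors of a prime power form a chain.\<close>

lemma dominating_if_primepow:
  assumes "primepow n"
  shows "zn.dominating n i"
proof -
  obtain p k where p: "prime p" "n = p ^ k" using assms by (auto simp: primepow_def)
  have "gcd i n dvd gcd j n \<or> gcd j n dvd gcd i n" for j
  proof -
    obtain a b where "gcd i n = p ^ a" "gcd j n = p ^ b"
      using p by (metis divides_primepow_nat gcd_dvd2)
    then show ?thesis by (metis le_imp_power_dvd nat_le_linear)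
  qed
  then show ?thesis
    by (auto simp: zn.dominating_def gcd_comparable_def)
qed

section \<open>Primary parts and connectedness of the complement\<close>

definition primary_part :: "nat \<Rightarrow> nat \<Rightarrow> nat" where
  "primary_part n p = p ^ multiplicity p n"

text \<open>Some primary part does not divide \<open>d\<close>, since otherwise \<open>n\<close>
  would. If \<open>d\<close> divides that part, \<open>d\<close> is a nontrivial power of
  \<open>p\<close>, and the part of any other prime factor \<open>q\<close> works; \<open>q\<close>
  exists as \<open>n\<close> is not a prime power.\<close>

lemma exists_incomparable_primary_part:
  assumes "n > 0" "\<not> primepow n" "d dvd n" "d \<noteq> 1" "d \<noteq> n"
  shows "\<exists>p\<in>prime_factors n. \<not> d dvd primary_part n p \<and> \<not> primary_part n p dvd d"
proof -
  have "d \<noteq> 0" using assms by auto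
  have "\<exists>p\<in>prime_factors n. \<not> primary_part n p dvd d"
  proof (rule ccontr)
    assume *: "\<not> ?thesis"
    have "n dvd d"
    proof (rule multiplicity_le_imp_dvd)
      fix p :: nat assume "prime p"
      show "multiplicity p n \<le> multiplicity p d"
      proof (cases "p dvd n")
        case True
        then have "p ^ multiplicity p n dvd d"
          using * \<open>prime p\<close> assms(1) by (auto simp: primary_part_def prime_factors_dvd)
        then show ?thesis
          using \<open>prime p\<close> \<open>d \<noteq> 0\<close> by (intro multiplicity_geI) auto
      qed (simp add: not_dvd_imp_multiplicity_0)
    qed (use assms in simp)
    then show False using assms by (simp add: dvd_antisym)
  qed
  then obtain p where p: "p \<in> prime_factors n" "\<not> primary_part n p dvd d" by blast
  then have "prime p" by auto
  show ?thesis
  proof (cases "d dvd primary_part n p")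
    case False
    with p show ?thesis by blast
  next
    case True
    then obtain b where d: "d = p ^ b"
      unfolding primary_part_def using \<open>prime p\<close> by (meson divides_primepow_nat)
    then have "b > 0" using assms by (cases b) auto
    have "prime_factors n \<noteq> {p}"
    proof
      assume "prime_factors n = {p}"
      then have "n = p ^ multiplicity p n"
        using prod_prime_factors[of n] assms(1) by simp
      moreover have "multiplicity p n > 0"
        using p assms(1) by (auto simp: prime_factors_multiplicity)
      ultimately show False
        using assms(2) \<open>prime p\<close> unfolding primepow_def by blast
    qed
    then obtain q where q: "q \<in> prime_factors n" "q \<noteq> p" using p by blast
    then have "prime q" by auto
    have "\<not> p dvd q" "\<not> q dvd p"
      using \<open>prime p\<close> \<open>prime q\<close> q by (auto dest: primes_dvd_imp_eq)
    moreover have "p dvd d" using d \<open>b > 0\<close> by simp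
    moreover have "q dvd primary_part n q"
      using q by (auto simp: primary_part_def prime_factors_multiplicity intro!: dvd_power)
    ultimately have "\<not> d dvd primary_part n q" "\<not> primary_part n q dvd d"
      using d \<open>prime p\<close> \<open>prime q\<close> unfolding primary_part_def
      by (meson dvd_trans prime_dvd_power)+
    with q show ?thesis by blast
  qed
qed

lemma primary_part_dvd: "primary_part n p dvd n"
  by (simp add: primary_part_def multiplicity_dvd)

text \<open>A divisor \<open>e\<close> of \<open>n\<close> is its own gcd with \<open>n\<close>;
  either non-divisibility already excludes \<open>i = e\<close>.\<close>

lemma coedge_iff_of_dvd:
  assumes "e dvd n" "e < n" "i < n"
  shows "zn.coedge n i e \<longleftrightarrow> \<not> gcd i n dvd e \<and> \<not> e dvd gcd i n"
  using assms by (auto simp: zn.coedge_def gcd_comparable_def gcd_nat.absorb1)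

text \<open>Ensures that primary parts are vertices.\<close>

lemma primary_part_less:
  assumes "n > 0" "\<not> primepow n" "p \<in> prime_factors n"
  shows "primary_part n p < n"
proof -
  have "primary_part n p \<noteq> n"
  proof
    assume "primary_part n p = n"
    then have "n = p ^ multiplicity p n" by (simp add: primary_part_def)
    moreover have "prime p" "multiplicity p n > 0"
      using assms(3) by (auto simp: prime_factors_multiplicity)
    ultimately show False using assms(2) unfolding primepow_def by blast
  qed
  then show ?thesis
    using primary_part_dvd[of n p] assms(1) by (simp add: dvd_imp_le le_neq_implies_less)
qed

text \<open>Primary parts form a clique in the complement, because a nontrivial power of one prime
  never divides a power of another.\<close>

lemma coedge_primary_parts:
  assumes "n > 0" "\<not> primepow n" "p \<in> prime_factors n" "q \<in> prime_factors n" "p \<noteq> q"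
  shows "zn.coedge n (primary_part n p) (primary_part n q)"
proof -
  have ndvd: "\<not> primary_part n x dvd primary_part n y"
    if "x \<in> prime_factors n" "y \<in> prime_factors n" "x \<noteq> y" for x y
  proof
    assume "primary_part n x dvd primary_part n y"
    moreover have "x dvd primary_part n x"
      using that by (auto simp: primary_part_def prime_factors_multiplicity intro!: dvd_power)
    ultimately have "x dvd y"
      using that unfolding primary_part_def
      by (meson dvd_trans in_prime_factors_imp_prime prime_dvd_power)
    then show False using that by (metis in_prime_factors_imp_prime primes_dvd_imp_eq)
  qed
  show ?thesis
    using assms primary_part_less ndvd primary_part_dvd[of n p]
    by (subst coedge_iff_of_dvd) (auto simp: primary_part_dvd gcd_nat.absorb1)
qed

text \<open>The conditions on \<open>i\<close> say that \<open>gcd i n\<close> is neither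
  \<open>n\<close> nor 1. This links every remaining vertex to the clique of primary parts.\<close>

lemma coedge_primary_part:
  assumes "n > 0" "\<not> primepow n" "i < n" "i \<noteq> 0" "\<not> coprime i n"
  shows "\<exists>p\<in>prime_factors n. zn.coedge n i (primary_part n p)"
proof -
  have "gcd i n dvd i" by simp
  then have "gcd i n \<noteq> n" using assms by (metis dvd_imp_le leD neq0_conv)
  moreover have "gcd i n \<noteq> 1" using assms by (simp add: coprime_iff_gcd_eq_1)
  ultimately show ?thesis
    using exists_incomparable_primary_part[of n "gcd i n"] assms
    by (auto simp: coedge_iff_of_dvd primary_part_dvd primary_part_less)
qed

lemma dominating_iff_not_primepow:
  assumes "n > 0" "\<not> primepow n" "i < n"
  shows "zn.dominating n i \<longleftrightarrow> i = 0 \<or> coprime i n"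
  using assms coedge_primary_part[of n i] dominating_if_zero_or_coprime[of i n]
  by (auto simp: zn.dominating_def zn.coedge_def)

theorem theorem3p4:
  fixes n :: nat
  assumes "n > 1"
  shows "laplacian_multiplicity (power_graph (integer_mod_group n)) (real n) = totient n + 1
           \<longleftrightarrow> n = 4 \<or> \<not> primepow n"
proof -
  have mult: "laplacian_multiplicity (power_graph (integer_mod_group n)) (real n) =
      Polynomial.order (real n) (char_poly (zn.laplacian n))"
    using assms by (simp add: laplacian_multiplicity_def laplacian_matrix_integer_mod_group)
  show ?thesis
  proof (cases "primepow n")
    case True
    then have dom: "zn.dominating n i" for i by (rule dominating_if_primepow)
    \<comment> \<open>All vertices are dominating, so any \<open>r\<close> would do; here
      \<open>r = 0\<close>.\<close>
    have "Polynomial.order (real n) (char_poly (zn.laplacian n)) =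
        card {i. i < n \<and> i \<noteq> 0 \<and> zn.dominating n i}"
      using assms dom by (intro zn.order_char_poly_laplacian) auto
    also have "{i. i < n \<and> i \<noteq> 0 \<and> zn.dominating n i} = {0<..<n}"
      using dom by auto
    finally have "laplacian_multiplicity (power_graph (integer_mod_group n)) (real n) = n - 1"
      using mult by simp
    moreover have "n - 1 = totient n + 1 \<longleftrightarrow> n = 4"
    proof -
      obtain p k where p: "prime p" "k > 0" "n = p ^ k"
        using True by (auto simp: primepow_def)
      have n: "n = p * p ^ (k - 1)" using p by (cases k) auto
      have tot: "totient n = p ^ (k - 1) * (p - 1)"
        using p totient_prime_power[of p k] by simp
      \<comment> \<open>This turns the equation for \<open>n - 1\<close> into
        \<open>p ^ (k - 1) = 2\<close>.\<close>
      have "n = totient n + p ^ (k - 1)"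
        using prime_gt_1_nat[OF \<open>prime p\<close>] unfolding tot
        by (subst n) (cases p, auto simp: algebra_simps)
      then have "n - 1 = totient n + 1 \<longleftrightarrow> p ^ (k - 1) = 2"
        using assms by linarith
      also have "\<dots> \<longleftrightarrow> n = 4"
      proof
        assume 2: "p ^ (k - 1) = 2"
        then have "k - 1 \<noteq> 0" by (intro notI) simp
        then have "p dvd 2" using 2 by (metis dvd_power neq0_conv)
        then have "p = 2" using \<open>prime p\<close> by (simp add: primes_dvd_imp_eq)
        then show "n = 4" using n 2 by simp
      next
        assume "n = 4"
        moreover have "p dvd n" by (subst n) simp
        ultimately have "p dvd 2 ^ 2" by simp
        then have "p = 2"
          using \<open>prime p\<close> by (meson prime_dvd_power primes_dvd_imp_eq two_is_prime_nat)
        then show "p ^ (k - 1) = 2" using n \<open>n = 4\<close> by simp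
      qed
      finally show ?thesis .
    qed
    ultimately show ?thesis using True by simp
  next
    case False
    obtain p where p: "p \<in> prime_factors n"
      using assms by (metis prime_factor_nat nat_neq_iff prime_factors_dvd not_less0 in_prime_factors_iff)
    define r where "r = primary_part n p"
    have "r < n" using primary_part_less assms False p by (simp add: r_def)
    \<comment> \<open>The path goes from \<open>r\<close> to the primary part of \<open>q\<close>,
      or stays there if \<open>q = p\<close>, and then to \<open>i\<close>.\<close>
    have connected: "(zn.coedge n)\<^sup>*\<^sup>* r i" if i: "i < n" "\<not> (i = 0 \<or> coprime i n)" for i
    proof -
      obtain q where q: "q \<in> prime_factors n" "zn.coedge n i (primary_part n q)"
        using coedge_primary_part[of n i] assms False i by auto
      have "(zn.coedge n)\<^sup>*\<^sup>* r (primary_part n q)"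
        using coedge_primary_parts[of n p q] assms False p q by (cases "p = q") (auto simp: r_def)
      then show ?thesis
        using zn.coedge_sym[OF q(2)] by simp
    qed
    \<comment> \<open>Hence \<open>r\<close> is not dominating, and excluding it from the count
      drops nothing.\<close>
    have "\<not> coprime r n" "r \<noteq> 0"
    proof -
      have "p dvd n" "prime p" using p by auto
      moreover have "p dvd r"
        using p by (auto simp: r_def primary_part_def prime_factors_multiplicity intro!: dvd_power)
      ultimately show "\<not> coprime r n"
        by (metis coprime_common_divisor not_prime_unit)
      show "r \<noteq> 0" using \<open>prime p\<close> by (auto simp: r_def primary_part_def)
    qed
    then have r: "{i. i < n \<and> i \<noteq> r \<and> zn.dominating n i} = {i. i < n \<and> (i = 0 \<or> coprime i n)}"
      using assms False dominating_iff_not_primepow by auto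
    have "Polynomial.order (real n) (char_poly (zn.laplacian n)) = totient n + 1"
      using zn.order_char_poly_laplacian[OF \<open>r < n\<close>] connected assms
        dominating_if_zero_or_coprime card_zero_or_coprime r by metis
    then show ?thesis using mult False by simp
  qed
qed

end
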